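(* Let $F$ be an unsatisfiable hitting clause-set and $v\in\mathrm{var}(F)$ with $\mathrm{ldeg}_F(v)=\mathrm{ldeg}_F(\overline v)=2$. Then $F$ is fs-resolvable, or $F$ admits an nfs-flip whose result is fs-resolvable.
   Context: Variables are positive integers, literals are nonzero integers, the complement of $x$ is $\overline{x}=-x$, $\mathrm{var}(x)=|x|$. A clause is a finite set of literals with no pair $x,\overline{x}$; a clause-set is a finite set of clauses; $\mathrm{var}(F)$ is the set of variables occurring in $F$. $F$ is satisfiable if some clause meets every clause of $F$, otherwise unsatisfiable. $F$ is hitting if any two distinct clauses $C,D\in F$ have some $x\in C$ with $\overline{x}\in D$. $\mathrm{ldeg}_F(x)$ is the number of clauses of $F$ containing $x$. An fs-pair is $\{E\cup\{w\},E\cup\{\overline w\}\}$ with $E$ a clause and $w,\overline w\notin E$; $F$ is fs-resolvable if it contains an fs-pair $\{E\cup\{w\},E\cup\{\overline w\}\}$ with $E\notin F$. An nfs-pair is $\{E\cup\{x\},E\cup\{\overline{x},y\}\}$ with $E$ a clause, $\mathrm{var}(x)\ne\mathrm{var}(y)$, $x,\overline x,y,\overline y\notin E$; its nfs-flip is $\{E\cup\{x,\overline y\},E\cup\{y\}\}$. An nfs-flip on $F$ replaces an nfs-pair $P\subseteq F$, neither of whose flip clauses lies in $F$, by its nfs-flip. *)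

theory Defs
  imports Main
begin

text \<open>
  Variables are the positive integers, literals the nonzero integers; the complement of a
  literal \<open>x\<close> is \<open>- x\<close> and its underlying variable is \<open>\<bar>x\<bar>\<close>.
\<close>

definition literal :: "int \<Rightarrow> bool" where
  "literal x \<longleftrightarrow> x \<noteq> 0"

definition clause :: "int set \<Rightarrow> bool" where
  "clause C \<longleftrightarrow> finite C \<and> (\<forall>x\<in>C. literal x) \<and> (\<forall>x\<in>C. - x \<notin> C)"

definition clause_set :: "int set set \<Rightarrow> bool" where
  "clause_set F \<longleftrightarrow> finite F \<and> (\<forall>C\<in>F. clause C)"

definition vars :: "int set set \<Rightarrow> int set" where
  "vars F = abs ` (\<Union>F)"

definition satisfiable :: "int set set \<Rightarrow> bool" where
  "satisfiable F \<longleftrightarrow> (\<exists>A. clause A \<and> (\<forall>C\<in>F. A \<inter> C \<noteq> {}))"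

definition hitting :: "int set set \<Rightarrow> bool" where
  "hitting F \<longleftrightarrow> (\<forall>C\<in>F. \<forall>D\<in>F. C \<noteq> D \<longrightarrow> (\<exists>x\<in>C. - x \<in> D))"

definition ldeg :: "int set set \<Rightarrow> int \<Rightarrow> nat" where
  "ldeg F x = card {C \<in> F. x \<in> C}"

definition fs_pair :: "int set \<Rightarrow> int \<Rightarrow> int set set \<Rightarrow> bool" where
  "fs_pair E w P \<longleftrightarrow>
     clause E \<and> literal w \<and> w \<notin> E \<and> - w \<notin> E \<and> P = {E \<union> {w}, E \<union> {- w}}"

definition fs_resolvable :: "int set set \<Rightarrow> bool" where
  "fs_resolvable F \<longleftrightarrow> (\<exists>E w P. fs_pair E w P \<and> P \<subseteq> F \<and> E \<notin> F)"

definition nfs_pair :: "int set \<Rightarrow> int \<Rightarrow> int \<Rightarrow> int set set \<Rightarrow> bool" where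
  "nfs_pair E x y P \<longleftrightarrow>
     clause E \<and> literal x \<and> literal y \<and> \<bar>x\<bar> \<noteq> \<bar>y\<bar> \<and>
     x \<notin> E \<and> - x \<notin> E \<and> y \<notin> E \<and> - y \<notin> E \<and>
     P = {E \<union> {x}, E \<union> {- x, y}}"

definition nfs_flip :: "int set \<Rightarrow> int \<Rightarrow> int \<Rightarrow> int set set" where
  "nfs_flip E x y = {E \<union> {x, - y}, E \<union> {y}}"

text \<open>
  \<open>nfs_flip_step F G\<close>: the clause-set \<open>G\<close> is the result of an nfs-flip on \<open>F\<close>.  The data
  \<open>E\<close>, \<open>x\<close>, \<open>y\<close> are determined by the pair \<open>P\<close>: its smaller clause is \<open>E \<union> {x}\<close>, and \<open>x\<close> is
  the only literal of that clause whose complement lies in the other clause.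
\<close>

definition nfs_flip_step :: "int set set \<Rightarrow> int set set \<Rightarrow> bool" where
  "nfs_flip_step F G \<longleftrightarrow>
     (\<exists>E x y P. nfs_pair E x y P \<and> P \<subseteq> F \<and> nfs_flip E x y \<inter> F = {} \<and>
        G = (F - P) \<union> nfs_flip E x y)"

end

theory Submission
  imports Defs
begin

text \<open>
  Read a clause as the subcube of the total assignments falsifying it: an unsatisfiable hitting
  clause-set is then a partition of the cube into subcubes. Removing \<open>v\<close> and \<open>- v\<close> from the four
  clauses containing them gives subcubes with \<open>C1 \<uplus> C2 = D1 \<uplus> D2\<close>. Two such decompositions either
  share a part, or one of them consists of two halves of a subcube, or they differ by an nfs-flip.
  In the first two cases \<open>F\<close> is fs-resolvable; in the third, an nfs-flip of the two clauses
  containing \<open>v\<close> makes them agree, up to the sign of \<open>v\<close>, with those containing \<open>- v\<close>.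
\<close>

section \<open>Total assignments and the clauses they falsify\<close>

text \<open>
  A total assignment is represented by the set of literals that it falsifies, so that a clause \<open>C\<close>
  is falsified by \<open>A\<close> iff \<open>C \<subseteq> A\<close>.
\<close>

definition total_assignment :: "int set \<Rightarrow> bool" where
  "total_assignment A \<longleftrightarrow> (\<forall>x. x \<in> A \<longleftrightarrow> x \<noteq> 0 \<and> - x \<notin> A)"

lemma total_assignment_extends:
  assumes "\<And>x. x \<in> S \<Longrightarrow> x \<noteq> 0 \<and> - x \<notin> S"
  obtains A where "total_assignment A" "S \<subseteq> A"
proof
  \<comment> \<open>Variables left undecided by \<open>S\<close> contribute their positive
    literal.\<close>
  show "total_assignment (S \<union> {x. x > 0 \<and> - x \<notin> S})"
    unfolding total_assignment_def
  proof
    fix x :: int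
    show "x \<in> S \<union> {x. x > 0 \<and> - x \<notin> S} \<longleftrightarrow> x \<noteq> 0 \<and> - x \<notin> S \<union> {x. x > 0 \<and> - x \<notin> S}"
      using assms[of x] assms[of "- x"] by (cases x "0::int" rule: linorder_cases) auto
  qed
qed auto

lemma total_assignment_update:
  assumes "total_assignment A" "v \<noteq> 0"
  shows "total_assignment (insert v (A - {- v}))"
  unfolding total_assignment_def
proof
  fix x
  show "x \<in> insert v (A - {- v}) \<longleftrightarrow> x \<noteq> 0 \<and> - x \<notin> insert v (A - {- v})"
    using assms unfolding total_assignment_def
    by (metis Diff_iff insert_iff minus_minus neg_equal_zero singletonD)
qed

lemma unsatisfiable_falsified_clause:
  assumes "clause_set F" "\<not> satisfiable F" "total_assignment A"
  obtains C where "C \<in> F" "C \<subseteq> A"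
proof -
  have "finite (\<Union>F)"
    using assms(1) by (auto simp: clause_set_def clause_def)
  moreover have "x \<noteq> 0" if "x \<in> \<Union>F" for x
    using that assms(1) by (auto simp: clause_set_def clause_def literal_def)
  moreover have "- x \<in> A" if "x \<noteq> 0" "x \<notin> A" for x
    using that assms(3) unfolding total_assignment_def by blast
  \<comment> \<open>A total assignment is infinite, so it cannot serve as a satisfying clause; the
    literals of \<open>F\<close> that \<open>A\<close> makes true can.\<close>
  ultimately have "clause (\<Union>F - A)"
    unfolding clause_def literal_def by (metis DiffD1 DiffD2 finite_Diff)
  then obtain C where "C \<in> F" "(\<Union>F - A) \<inter> C = {}"
    using assms(2) by (auto simp: satisfiable_def)
  then show ?thesis
    using that by blast
qed

lemma hitting_falsified_unique:
  assumes "hitting F" "total_assignment A" "C \<in> F" "C \<subseteq> A" "D \<in> F" "D \<subseteq> A"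
  shows "C = D"
  using assms unfolding hitting_def total_assignment_def by (meson subsetD)

text \<open>Flip \<open>v\<close>: a clause falsified by \<open>?A2\<close> and free of
  \<open>- v\<close> would also be falsified by \<open>?A1\<close>, where \<open>C\<close> is the
  only falsified clause. Used with \<open>v\<close> and with \<open>- v\<close>, this gives both
  inclusions of \<open>C1 \<uplus> C2 = D1 \<uplus> D2\<close>.\<close>

lemma falsified_opposite_side:
  assumes F: "clause_set F" "\<not> satisfiable F" "hitting F"
    and A: "total_assignment A"
    and C: "C \<in> F" "v \<in> C" "C - {v} \<subseteq> A"
  shows "\<exists>D\<in>F. - v \<in> D \<and> D - {- v} \<subseteq> A"
proof -
  have v: "v \<noteq> 0" "- v \<notin> C"
    using F(1) C by (auto simp: clause_set_def clause_def literal_def)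
  let ?A1 = "insert v (A - {- v})" and ?A2 = "insert (- v) (A - {v})"
  have A1: "total_assignment ?A1"
    using total_assignment_update[OF A v(1)] .
  have A2: "total_assignment ?A2"
    using total_assignment_update[OF A, of "- v"] v by simp
  have "C \<subseteq> ?A1"
    using C v by auto
  obtain D where D: "D \<in> F" "D \<subseteq> ?A2"
    using unsatisfiable_falsified_clause[OF F(1,2) A2] .
  have "v \<noteq> - v"
    using v by auto
  have "- v \<in> D"
  proof (rule ccontr)
    assume "- v \<notin> D"
    then have "D \<subseteq> ?A1"
      using D by auto
    then have "D = C"
      using hitting_falsified_unique[OF F(3) A1] C D \<open>C \<subseteq> ?A1\<close> by blast
    then show False
      using D(2) C(2) \<open>v \<noteq> - v\<close> by auto
  qed
  then show ?thesis
    using D by blast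
qed

section \<open>Covering one subcube by two others\<close>

text \<open>The three ways in which the subcubes of \<open>D1\<close> and \<open>D2\<close> can cover the subcube of \<open>X\<close>.\<close>

definition covered :: "int set \<Rightarrow> int set \<Rightarrow> int set \<Rightarrow> bool" where
  "covered X D1 D2 \<longleftrightarrow> D1 \<subseteq> X \<or> D2 \<subseteq> X \<or> (\<exists>w. D1 - X = {w} \<and> D2 - X = {- w})"

text \<open>An assignment falsifying \<open>X\<close> but satisfying some
  \<open>a \<in> D1 - X\<close> and some \<open>b \<in> D2 - X\<close> escapes the cover; only
  \<open>a = - b\<close> prevents this. If both differences are nonempty and all such pairs are
  complementary, both are singletons.\<close>

lemma coveredI:
  assumes "clause X" "clause D1" "clause D2"
    and cov: "\<And>A. total_assignment A \<Longrightarrow> X \<subseteq> A \<Longrightarrow> D1 \<subseteq> A \<or> D2 \<subseteq> A"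
  shows "covered X D1 D2"
proof -
  have opp: "a = - b" if "a \<in> D1 - X" "b \<in> D2 - X" for a b
  proof (rule ccontr)
    assume "a \<noteq> - b"
    then have "x \<noteq> 0 \<and> - x \<notin> X \<union> {- a, - b}" if "x \<in> X \<union> {- a, - b}" for x
      using that assms(1-3) \<open>a \<in> D1 - X\<close> \<open>b \<in> D2 - X\<close>
      by (auto simp: clause_def literal_def)
    then obtain A where A: "total_assignment A" "X \<union> {- a, - b} \<subseteq> A"
      by (rule total_assignment_extends)
    then have "a \<notin> A" "b \<notin> A"
      by (meson insertI1 insert_subset le_sup_iff total_assignment_def)+
    then show False
      using cov[OF A(1)] A(2) that by auto
  qed
  show ?thesis
  proof (cases "D1 \<subseteq> X \<or> D2 \<subseteq> X")
    case False
    then obtain a b where ab: "a \<in> D1 - X" "b \<in> D2 - X"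
      by blast
    then have "D1 - X = {a}" "D2 - X = {- a}"
      using opp by (auto, (metis Diff_iff minus_minus)+)
    then show ?thesis
      unfolding covered_def by blast
  qed (auto simp: covered_def)
qed

text \<open>Hitting makes the condition \<open>E \<notin> F\<close> automatic: \<open>E\<close>
  cannot clash with the clause \<open>insert w E\<close> containing it.\<close>

lemma hitting_fs_resolvable:
  assumes "clause_set F" "hitting F" "insert w E \<in> F" "insert (- w) E \<in> F" "w \<notin> E" "- w \<notin> E"
  shows "fs_resolvable F"
proof -
  have cl: "clause (insert w E)"
    using assms by (auto simp: clause_set_def)
  then have "clause E" "literal w"
    by (auto simp: clause_def)
  moreover have "E \<notin> F"
  proof
    assume "E \<in> F"
    then obtain x where "x \<in> E" "- x \<in> insert w E"
      using assms by (metis hitting_def insertI1)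
    then show False
      using cl by (auto simp: clause_def)
  qed
  ultimately show ?thesis
    using assms unfolding fs_resolvable_def fs_pair_def
    by (intro exI[of _ E] exI[of _ w] exI[of _ "{E \<union> {w}, E \<union> {- w}}"]) auto
qed

section \<open>The clauses containing \<open>v\<close> or \<open>- v\<close>, and their
  remainders\<close>

locale degree_two =
  fixes F :: "int set set" and v :: int and C1 C2 D1 D2 :: "int set"
  assumes F: "clause_set F" "\<not> satisfiable F" "hitting F"
    and C: "{K \<in> F. v \<in> K} = {insert v C1, insert v C2}" "C1 \<noteq> C2"
    and D: "{K \<in> F. - v \<in> K} = {insert (- v) D1, insert (- v) D2}" "D1 \<noteq> D2"
    and v_notin: "v \<notin> C1" "v \<notin> C2" "- v \<notin> D1" "- v \<notin> D2"
begin

text \<open>Together with the next two lemmas, this generates the symmetries that allow each case to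
  be argued for one labelling only.\<close>

lemma swap_C: "degree_two F v C2 C1 D1 D2"
  using F C D v_notin by (simp add: degree_two_def insert_commute)

lemma swap_D: "degree_two F v C1 C2 D2 D1"
  using F C D v_notin by (simp add: degree_two_def insert_commute)

lemma swap_sides: "degree_two F (- v) D1 D2 C1 C2"
  using F C D v_notin by (simp add: degree_two_def insert_commute)

lemma in_F: "insert v C1 \<in> F" "insert v C2 \<in> F" "insert (- v) D1 \<in> F" "insert (- v) D2 \<in> F"
  using C(1) D(1) by blast+

lemma clauses_v:
  "clause (insert v C1)" "clause (insert v C2)" "clause (insert (- v) D1)" "clause (insert (- v) D2)"
  using F(1) in_F by (auto simp: clause_set_def)

lemma clauses: "clause C1" "clause C2" "clause D1" "clause D2"
  using clauses_v by (auto simp: clause_def)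

lemma v_nonzero: "v \<noteq> 0"
  using clauses_v(1) by (auto simp: clause_def literal_def)

lemma v_notin': "- v \<notin> C1" "- v \<notin> C2" "v \<notin> D1" "v \<notin> D2"
  using clauses_v by (auto simp: clause_def)

lemma clash_C: "\<exists>x\<in>C1. - x \<in> C2"
proof -
  have "insert v C1 \<noteq> insert v C2"
    using C(2) v_notin by auto
  then obtain x where "x \<in> insert v C1" "- x \<in> insert v C2"
    using F(3) in_F(1,2) unfolding hitting_def by meson
  then show ?thesis
    using v_notin' v_nonzero
    by (metis add.inverse_inverse insert_iff neg_equal_zero)
qed

lemma covered_C1: "covered C1 D1 D2"
proof (rule coveredI[OF clauses(1,3,4)])
  fix A assume A: "total_assignment A" "C1 \<subseteq> A"
  obtain K where "K \<in> F" "- v \<in> K" "K - {- v} \<subseteq> A"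
    using falsified_opposite_side[OF F A(1) in_F(1), of v] A(2) by blast
  then show "D1 \<subseteq> A \<or> D2 \<subseteq> A"
    using D(1) v_notin by auto
qed

lemmas covered_C2 = degree_two.covered_C1[OF swap_C]
lemmas covered_D1 = degree_two.covered_C1[OF swap_sides]
lemmas covered_D2 = degree_two.covered_C1[OF degree_two.swap_C[OF swap_sides]]
lemmas clash_D = degree_two.clash_C[OF swap_sides]

lemma fs_resolvable_common:
  assumes "C1 = D1"
  shows "fs_resolvable F"
  using hitting_fs_resolvable[OF F(1,3), of v C1] in_F v_notin v_notin' assms by auto

lemma fs_resolvable_halves:
  assumes "C1 = insert w E" "C2 = insert (- w) E" "w \<notin> E" "- w \<notin> E"
  shows "fs_resolvable F"
proof (rule hitting_fs_resolvable[OF F(1,3), of w "insert v E"])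
  show "insert w (insert v E) \<in> F" "insert (- w) (insert v E) \<in> F"
    using in_F assms by (auto simp: insert_commute)
  show "w \<notin> insert v E" "- w \<notin> insert v E"
    using v_notin assms by auto
qed

text \<open>The flip turns the two clauses containing \<open>v\<close> into
  \<open>insert v D1\<close> and \<open>insert v D2\<close>; the first forms an fs-pair on
  \<open>v\<close> with \<open>insert (- v) D1\<close>.\<close>

lemma nfs_flip_fs_resolvable:
  assumes eq: "C1 = insert x E" "C2 = insert (- x) (insert y E)"
      "D1 = insert x (insert (- y) E)" "D2 = insert y E"
    and E: "x \<notin> E" "- x \<notin> E" "y \<notin> E" "- y \<notin> E" "\<bar>x\<bar> \<noteq> \<bar>y\<bar>"
  shows "\<exists>G. nfs_flip_step F G \<and> fs_resolvable G"
proof -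
  let ?E = "insert v E"
  let ?P = "{?E \<union> {x}, ?E \<union> {- x, y}}"
  let ?Q = "nfs_flip ?E x y"
  let ?G = "(F - ?P) \<union> ?Q"
  have P: "?P = {insert v C1, insert v C2}"
    unfolding eq by (auto simp: insert_commute)
  have Q: "?Q = {insert v D1, insert v D2}"
    unfolding eq nfs_flip_def by (auto simp: insert_commute)
  have "clause ?E" "literal x" "literal y"
    using clauses_v unfolding eq by (auto simp: clause_def)
  then have "nfs_pair ?E x y ?P"
    using E v_notin v_notin' unfolding nfs_pair_def eq by auto
  moreover have "?P \<subseteq> F"
    using P in_F by auto
  \<comment> \<open>Both flip clauses contain \<open>v\<close>, so in \<open>F\<close> they could
    only be \<open>insert v C1\<close> or \<open>insert v C2\<close>.\<close>
  moreover have "?Q \<inter> F = {}"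
  proof -
    have "- y \<in> D1" "- y \<notin> C1" "y \<in> D2" "y \<notin> C1" "x \<in> D1" "x \<notin> C2" "- x \<in> C2" "- x \<notin> D2"
      using E \<open>literal x\<close> unfolding eq literal_def by auto
    then have "C1 \<noteq> D1" "C1 \<noteq> D2" "C2 \<noteq> D1" "C2 \<noteq> D2"
      by metis+
    then have "insert v D1 \<notin> {K \<in> F. v \<in> K}" "insert v D2 \<notin> {K \<in> F. v \<in> K}"
      unfolding C(1) using v_notin v_notin' by (auto simp: insert_ident)
    then show ?thesis
      unfolding Q by auto
  qed
  ultimately have "nfs_flip_step F ?G"
    unfolding nfs_flip_step_def by blast
  moreover have "fs_resolvable ?G"
  proof -
    have "insert (- v) D1 \<notin> ?P"
      unfolding P using v_notin' v_nonzero by auto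
    then have "insert (- v) D1 \<in> ?G" "insert v D1 \<in> ?G"
      using in_F Q by auto
    \<comment> \<open>Hitting is at hand for \<open>F\<close> only. Since
      \<open>v \<notin> D1\<close>, \<open>D1\<close> is no flip clause, so it would lie in
      \<open>F\<close> and clash with its superset \<open>insert (- v) D1\<close>.\<close>
    moreover have "D1 \<notin> ?G"
    proof
      assume "D1 \<in> ?G"
      then have "D1 \<in> F"
        using Q v_notin' by auto
      moreover have "D1 \<noteq> insert (- v) D1"
        using v_notin by auto
      ultimately obtain z where "z \<in> D1" "- z \<in> insert (- v) D1"
        using F(3) in_F(3) unfolding hitting_def by meson
      then show False
        using clauses_v(3) by (auto simp: clause_def)
    qed
    ultimately show ?thesis
      using clauses v_notin v_notin' v_nonzero
      unfolding fs_resolvable_def fs_pair_def literal_def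
      by (intro exI[of _ D1] exI[of _ v] exI[of _ "{D1 \<union> {v}, D1 \<union> {- v}}"]) auto
  qed
  ultimately show ?thesis
    by blast
qed

section \<open>Nested and crossing decompositions\<close>

text \<open>The subcube of \<open>D1\<close> lies in that of \<open>C1\<close>; complementing within
  the common union, the subcube of \<open>C2\<close> lies in that of \<open>D2\<close>. At most one
  literal \<open>u\<close> separates \<open>D1\<close> from \<open>C1\<close>, and the way
  \<open>D2\<close> is covered decides the outcome.\<close>

lemma nested_case:
  assumes sub: "C1 \<subseteq> D1"
  shows "fs_resolvable F \<or> (\<exists>G. nfs_flip_step F G \<and> fs_resolvable G)"
proof -
  \<comment> \<open>A clash literal \<open>x\<close> lies in \<open>D1 - C2\<close>, which excludes
    \<open>D1 \<subseteq> C2\<close>; since \<open>- x \<in> C2\<close>, complementary singletons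
    are excluded too.\<close>
  have "D2 \<subseteq> C2"
  proof -
    obtain x where x: "x \<in> C1" "- x \<in> C2" "x \<notin> C2"
      using clash_C clauses(2) by (auto simp: clause_def)
    then have "x \<in> D1 - C2"
      using sub by auto
    moreover have "- x \<notin> D2 - C2"
      using x(2) by auto
    ultimately show ?thesis
      using covered_C2 unfolding covered_def by (metis Diff_eq_empty_iff empty_iff insertI1 singletonD)
  qed
  \<comment> \<open>\<open>D2 \<subseteq> C1\<close> is impossible: it would put \<open>D2\<close>
    inside \<open>D1\<close>, with which it clashes.\<close>
  consider "D1 \<subseteq> C1" | u where "D1 - C1 = {u}" "D2 - C1 = {- u}"
  proof -
    obtain x where "x \<in> D1" "- x \<in> D2" "- x \<notin> D1"
      using clash_D clauses(3) by (auto simp: clause_def)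
    then have "\<not> D2 \<subseteq> C1"
      using sub by auto
    then show ?thesis
      using covered_C1 that unfolding covered_def by auto
  qed
  then show ?thesis
  proof cases
    case 1
    then show ?thesis
      using sub fs_resolvable_common by blast
  next
    case u: 2
    consider "C1 \<subseteq> D2" | "C2 \<subseteq> D2" | w where "C1 - D2 = {w}" "C2 - D2 = {- w}"
      using covered_D2 unfolding covered_def by blast
    then show ?thesis
    proof cases
      case 1
      then have "D1 = insert u C1" "D2 = insert (- u) C1" "u \<notin> C1" "- u \<notin> C1"
        using u sub by auto
      then show ?thesis
        using degree_two.fs_resolvable_halves[OF swap_sides] by blast
    next
      case 2
      then have "C2 = D2"
        using \<open>D2 \<subseteq> C2\<close> by auto
      then show ?thesis
        using degree_two.fs_resolvable_common[OF degree_two.swap_C[OF swap_D]] by blast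
    next
      case w: 3
      \<comment> \<open>This is the flip configuration with \<open>x = w\<close> and
        \<open>y = - u\<close>, hence the double negation in \<open>eq\<close>.\<close>
      define E where "E = C1 \<inter> D2"
      have eq: "C1 = insert w E" "D2 = insert (- u) E"
        "C2 = insert (- w) (insert (- u) E)" "D1 = insert w (insert (- (- u)) E)"
        using u w sub \<open>D2 \<subseteq> C2\<close> unfolding E_def by auto
      have mem: "w \<in> C1" "w \<notin> D2" "- u \<in> D2" "- u \<notin> C1" "u \<notin> C1"
        using u w by auto
      then have "w \<notin> E" "- w \<notin> E" "- u \<notin> E" "- (- u) \<notin> E"
        using clauses unfolding E_def clause_def by auto
      moreover have "\<bar>w\<bar> \<noteq> \<bar>- u\<bar>"
        using mem by (auto simp: abs_eq_iff)
      ultimately show ?thesis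
        using nfs_flip_fs_resolvable[OF eq(1,3,4,2)] by blast
    qed
  qed
qed

text \<open>Without nesting, every covering used is of the complementary kind. The literals
  \<open>a\<close> and \<open>b\<close> missing from \<open>C1\<close> and \<open>C2\<close> must
  agree, so \<open>C1\<close> and \<open>C2\<close> both arise from \<open>D1 - {a}\<close> by
  adding \<open>c\<close> and \<open>- c\<close>: they are two halves.\<close>

lemma crossing_case:
  assumes "\<not> D1 \<subseteq> C1" "\<not> D2 \<subseteq> C1" "\<not> D1 \<subseteq> C2" "\<not> D2 \<subseteq> C2" "\<not> C1 \<subseteq> D1" "\<not> C2 \<subseteq> D1"
  shows "fs_resolvable F"
proof -
  obtain a where a: "D1 - C1 = {a}" "D2 - C1 = {- a}"
    using covered_C1 assms unfolding covered_def by blast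
  obtain b where b: "D1 - C2 = {b}" "D2 - C2 = {- b}"
    using covered_C2 assms unfolding covered_def by blast
  obtain c where c: "C1 - D1 = {c}" "C2 - D1 = {- c}"
    using covered_D1 assms unfolding covered_def by blast
  have "a = b"
  proof (rule ccontr)
    assume "a \<noteq> b"
    have "a \<in> D1" "- a \<in> D2"
      using a by auto
    moreover have "a \<notin> D1 - C2" "- a \<notin> D2 - C2"
      unfolding b using \<open>a \<noteq> b\<close> by auto
    ultimately have "a \<in> C2" "- a \<in> C2"
      by auto
    then show False
      using clauses by (auto simp: clause_def)
  qed
  then have "C1 = insert c (D1 - {a})" "C2 = insert (- c) (D1 - {a})"
      "c \<notin> D1 - {a}" "- c \<notin> D1 - {a}"
    using a b c by auto
  then show ?thesis
    by (rule fs_resolvable_halves)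
qed

text \<open>Each of the six non-inclusions required by \<open>crossing_case\<close> fails only in a
  relabelled instance of \<open>nested_case\<close>.\<close>

lemma fs_resolvable_up_to_flip:
  "fs_resolvable F \<or> (\<exists>G. nfs_flip_step F G \<and> fs_resolvable G)"
  using crossing_case nested_case
    degree_two.nested_case[OF swap_C]
    degree_two.nested_case[OF swap_sides]
    degree_two.nested_case[OF degree_two.swap_C[OF swap_sides]]
    degree_two.nested_case[OF degree_two.swap_D[OF swap_sides]]
    degree_two.nested_case[OF degree_two.swap_D[OF degree_two.swap_C[OF swap_sides]]]
  by blast

end

lemma ldeg_two_remainders:
  assumes "ldeg F x = 2"
  obtains C1 C2 where "{K \<in> F. x \<in> K} = {insert x C1, insert x C2}" "C1 \<noteq> C2" "x \<notin> C1" "x \<notin> C2"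
proof -
  obtain K L where KL: "{K \<in> F. x \<in> K} = {K, L}" "K \<noteq> L"
    using assms unfolding ldeg_def by (auto simp: card_2_iff)
  then have "x \<in> K" "x \<in> L"
    by blast+
  then have ins: "insert x (K - {x}) = K" "insert x (L - {x}) = L"
    by auto
  show ?thesis
  proof (rule that[of "K - {x}" "L - {x}"])
    show "{K \<in> F. x \<in> K} = {insert x (K - {x}), insert x (L - {x})}"
      unfolding ins by (rule KL(1))
    show "K - {x} \<noteq> L - {x}"
      using ins KL(2) by metis
  qed auto
qed

theorem lemma24:
  fixes F :: "int set set" and v :: int
  assumes "clause_set F"
    and "\<not> satisfiable F"
    and "hitting F"
    and "v \<in> vars F"
    and "ldeg F v = 2"
    and "ldeg F (- v) = 2"
  shows "fs_resolvable F \<or> (\<exists>G. nfs_flip_step F G \<and> fs_resolvable G)"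
proof -
  obtain C1 C2 where C: "{K \<in> F. v \<in> K} = {insert v C1, insert v C2}" "C1 \<noteq> C2" "v \<notin> C1" "v \<notin> C2"
    using ldeg_two_remainders[OF assms(5)] .
  obtain D1 D2 where D: "{K \<in> F. - v \<in> K} = {insert (- v) D1, insert (- v) D2}" "D1 \<noteq> D2"
      "- v \<notin> D1" "- v \<notin> D2"
    using ldeg_two_remainders[OF assms(6)] .
  interpret degree_two F v C1 C2 D1 D2
    using assms(1-3) C D by unfold_locales
  show ?thesis
    by (rule fs_resolvable_up_to_flip)
qed

end
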